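(* Let $(A,\cdot)$ be an anti-flexible algebra over a field $\mathbb{K}$ of characteristic different from $2$ and let $N_J:A\to A$ be a Nijenhuis operator on $A$. Define, for all $x,y\in A$, $$x\succ y=N_J(x)\cdot y-\tfrac12 N_J(x\cdot y),\qquad x\prec y=x\cdot N_J(y)-\tfrac12 N_J(x\cdot y).$$ Then $(A,\prec,\succ)$ is a pre-anti-flexible algebra if and only if for all $x,y,z\in A$, $$\tfrac32 N_J\big(N_J(z\cdot y)\cdot x+x\cdot N_J(y\cdot z)\big)=N_J^2\big((z\cdot y)\cdot x+x\cdot(y\cdot z)\big).$$
   Context: An anti-flexible algebra is a $\mathbb{K}$-vector space $A$ with a bilinear product $\cdot$ such that $(x\cdot y)\cdot z-x\cdot(y\cdot z)=(z\cdot y)\cdot x-z\cdot(y\cdot x)$ for all $x,y,z\in A$. A Nijenhuis operator on an anti-flexible algebra $(A,\cdot)$ is a linear map $N_J:A\to A$ such that $N_J(x)\cdot N_J(y)=N_J\big(N_J(x)\cdot y+x\cdot N_J(y)-N_J(x\cdot y)\big)$ for all $x,y\in A$. A pre-anti-flexible algebra is a vector space $A$ with two bilinear products $\prec,\succ$ such that for all $x,y,z\in A$: (i) $(x\succ y)\prec z-x\succ(y\prec z)=(z\succ y)\prec x-z\succ(y\prec x)$; (ii) $(x\succ y+x\prec y)\succ z-x\succ(y\succ z)=(z\prec y)\prec x-z\prec(y\prec x+y\succ x)$.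
   Formalization: The "if" direction (the condition implies pre-anti-flexible) is stated only for characteristic different from 2 and 3, since it is false in characteristic 3 (2x2 matrices, N_J left multiplication by E_12); the "only if" direction is kept for every characteristic different from 2. *)

theory Defs
  imports Complex_Main
begin

text \<open>
  A vector space over the field \<open>'k\<close> is a type \<open>'a\<close> with a scalar multiplication \<open>scale\<close> satisfying the
  locale \<^locale>\<open>vector_space\<close>.
\<close>

definition bilinear_product ::
  "('k::field \<Rightarrow> 'a::ab_group_add \<Rightarrow> 'a) \<Rightarrow> ('a \<Rightarrow> 'a \<Rightarrow> 'a) \<Rightarrow> bool"
  where "bilinear_product scale mul \<longleftrightarrow>
    (\<forall>x. Vector_Spaces.linear scale scale (\<lambda>y. mul x y)) \<and>
    (\<forall>y. Vector_Spaces.linear scale scale (\<lambda>x. mul x y))"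

locale anti_flexible_algebra = vector_space scale
  for scale :: "'k::field \<Rightarrow> 'a::ab_group_add \<Rightarrow> 'a" +
  fixes mul :: "'a \<Rightarrow> 'a \<Rightarrow> 'a" (infixl "\<cdot>" 70)
  assumes bilinear: "bilinear_product scale (\<cdot>)"
    and anti_flexible: "(x \<cdot> y) \<cdot> z - x \<cdot> (y \<cdot> z) = (z \<cdot> y) \<cdot> x - z \<cdot> (y \<cdot> x)"

locale nijenhuis_operator = anti_flexible_algebra scale mul
  for scale :: "'k::field \<Rightarrow> 'a::ab_group_add \<Rightarrow> 'a"
    and mul :: "'a \<Rightarrow> 'a \<Rightarrow> 'a" (infixl "\<cdot>" 70) +
  fixes N :: "'a \<Rightarrow> 'a"
  assumes linear_N: "Vector_Spaces.linear scale scale N"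
    and nijenhuis: "N x \<cdot> N y = N (N x \<cdot> y + x \<cdot> N y - N (x \<cdot> y))"

locale pre_anti_flexible_algebra = vector_space scale
  for scale :: "'k::field \<Rightarrow> 'a::ab_group_add \<Rightarrow> 'a" +
  fixes prec :: "'a \<Rightarrow> 'a \<Rightarrow> 'a" (infixl "\<prec>" 70)
    and succ :: "'a \<Rightarrow> 'a \<Rightarrow> 'a" (infixl "\<succ>" 70)
  assumes bilinear_prec: "bilinear_product scale (\<prec>)"
    and bilinear_succ: "bilinear_product scale (\<succ>)"
    and pre_anti_flexible_1:
      "(x \<succ> y) \<prec> z - x \<succ> (y \<prec> z) = (z \<succ> y) \<prec> x - z \<succ> (y \<prec> x)"
    and pre_anti_flexible_2:
      "(x \<succ> y + x \<prec> y) \<succ> z - x \<succ> (y \<succ> z) = (z \<prec> y) \<prec> x - z \<prec> (y \<prec> x + y \<succ> x)"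

definition nijenhuis_succ ::
  "('k::field \<Rightarrow> 'a::ab_group_add \<Rightarrow> 'a) \<Rightarrow> ('a \<Rightarrow> 'a \<Rightarrow> 'a) \<Rightarrow> ('a \<Rightarrow> 'a) \<Rightarrow> 'a \<Rightarrow> 'a \<Rightarrow> 'a"
  where "nijenhuis_succ scale mul N x y = mul (N x) y - scale (1 / 2) (N (mul x y))"

definition nijenhuis_prec ::
  "('k::field \<Rightarrow> 'a::ab_group_add \<Rightarrow> 'a) \<Rightarrow> ('a \<Rightarrow> 'a \<Rightarrow> 'a) \<Rightarrow> ('a \<Rightarrow> 'a) \<Rightarrow> 'a \<Rightarrow> 'a \<Rightarrow> 'a"
  where "nijenhuis_prec scale mul N x y = mul x (N y) - scale (1 / 2) (N (mul x y))"

text \<open>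
  In characteristic 3 the scalar 3/2 is 0, so this condition degenerates to the vanishing of its
  right-hand side and no longer implies the pre-anti-flexible identities. Example: the algebra of
  2x2 matrices over a field of characteristic 3, with \<open>N\<close> the left multiplication by the matrix
  unit \<open>E\<^sub>1\<^sub>2\<close>. This \<open>N\<close> is a Nijenhuis operator with \<open>N\<^sup>2 = 0\<close>, so the condition holds, but the first
  identity fails for \<open>x = 1\<close>, \<open>y = 1\<close>, \<open>z = E\<^sub>2\<^sub>1\<close>. The converse therefore needs
  characteristic different from 3.
\<close>

definition nijenhuis_condition ::
  "('k::field \<Rightarrow> 'a::ab_group_add \<Rightarrow> 'a) \<Rightarrow> ('a \<Rightarrow> 'a \<Rightarrow> 'a) \<Rightarrow> ('a \<Rightarrow> 'a) \<Rightarrow> bool"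
  where "nijenhuis_condition scale mul N \<longleftrightarrow>
    (\<forall>x y z. scale (3 / 2) (N (mul (N (mul z y)) x + mul x (N (mul y z)))) =
       N (N (mul (mul z y) x + mul x (mul y z))))"

end

theory Submission
  imports Defs "HOL-Computational_Algebra.Primes"
begin

text \<open>
  Put \<open>S x y z = N (N (z y) x + x N (y z))\<close> and \<open>T x y z = N (N ((z y) x + x (y z)))\<close>. Expanding
  both pre-anti-flexible identities with the Nijenhuis identity, all terms except those in \<open>S\<close> and
  \<open>T\<close> assemble into associators, which cancel by anti-flexibility. The first identity becomes
  \<open>S x y z = S z y x\<close> and the second one becomes \<open>S z y x / 2 + S x y z / 4 = T x y z / 2\<close>. Together
  they say \<open>3/2 S = T\<close>; conversely \<open>T\<close> is symmetric in its outer arguments by anti-flexibility, so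
  \<open>3/2 S = T\<close> forces the symmetry of \<open>S\<close> as soon as 3 is invertible.
\<close>

text \<open>The value 1/4 is the coefficient \<open>h - h * h\<close> of the expansions below at h =
  1/2; the sum 3/4 is where the 3/2 of the condition comes from.\<close>

lemma half_quarter_arith:
  assumes "(2::'k::field) \<noteq> 0"
  shows "1 / 2 - 1 / 2 * (1 / 2) = (1 / 4 :: 'k)" and "1 / 2 + 1 / 4 = (1 / 2 * (3 / 2) :: 'k)"
proof -
  have "(4::'k) \<noteq> 0"
    using no_zero_divisors[OF assms assms] by simp
  moreover from no_zero_divisors[OF assms this] have "(8::'k) \<noteq> 0"
    by simp
  ultimately show "1 / 2 - 1 / 2 * (1 / 2) = (1 / 4 :: 'k)" "1 / 2 + 1 / 4 = (1 / 2 * (3 / 2) :: 'k)"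
    using assms by (simp_all add: divide_simps)
qed

lemma bilinear_productI:
  fixes scale :: "'k::field \<Rightarrow> 'a::ab_group_add \<Rightarrow> 'a"
  assumes "vector_space scale"
    and "\<And>x y z. p x (y + z) = p x y + p x z" "\<And>x y z. p (x + y) z = p x z + p y z"
    and "\<And>c x y. p x (scale c y) = scale c (p x y)" "\<And>c x y. p (scale c x) y = scale c (p x y)"
  shows "bilinear_product scale p"
  unfolding bilinear_product_def by (simp add: Vector_Spaces.linear_iff assms)

context anti_flexible_algebra
begin

lemma
  mul_add_right: "x \<cdot> (y + z) = x \<cdot> y + x \<cdot> z" and
  mul_diff_right: "x \<cdot> (y - z) = x \<cdot> y - x \<cdot> z" and
  mul_scale_right: "x \<cdot> scale c y = scale c (x \<cdot> y)"
proof -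
  interpret l: Vector_Spaces.linear scale scale "(\<cdot>) x"
    using bilinear unfolding bilinear_product_def by blast
  show "x \<cdot> (y + z) = x \<cdot> y + x \<cdot> z" "x \<cdot> (y - z) = x \<cdot> y - x \<cdot> z"
    "x \<cdot> scale c y = scale c (x \<cdot> y)"
    by (rule l.add l.diff l.scale)+
qed

lemma
  mul_add_left: "(x + y) \<cdot> z = x \<cdot> z + y \<cdot> z" and
  mul_diff_left: "(x - y) \<cdot> z = x \<cdot> z - y \<cdot> z" and
  mul_scale_left: "scale c x \<cdot> z = scale c (x \<cdot> z)"
proof -
  interpret l: Vector_Spaces.linear scale scale "\<lambda>x. x \<cdot> z"
    using bilinear unfolding bilinear_product_def by blast
  show "(x + y) \<cdot> z = x \<cdot> z + y \<cdot> z" "(x - y) \<cdot> z = x \<cdot> z - y \<cdot> z"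
    "scale c x \<cdot> z = scale c (x \<cdot> z)"
    by (rule l.add l.diff l.scale)+
qed

lemmas mul_linear = mul_add_right mul_diff_right mul_scale_right
  mul_add_left mul_diff_left mul_scale_left

definition associator :: "'a \<Rightarrow> 'a \<Rightarrow> 'a \<Rightarrow> 'a"
  where "associator x y z = (x \<cdot> y) \<cdot> z - x \<cdot> (y \<cdot> z)"

text \<open>All cancellations in the two pre-anti-flexible identities use anti-flexibility in this
  form.\<close>

lemma associator_swap: "associator x y z = associator z y x"
  unfolding associator_def by (rule anti_flexible)

end

context nijenhuis_operator
begin

sublocale N: Vector_Spaces.linear scale scale N
  by (rule linear_N)

abbreviation nij_succ (infixl "\<succ>" 70) where "nij_succ \<equiv> nijenhuis_succ scale mul N"
abbreviation nij_prec (infixl "\<prec>" 70) where "nij_prec \<equiv> nijenhuis_prec scale mul N"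

lemmas nijenhuis_expand = nijenhuis_succ_def nijenhuis_prec_def mul_linear N.add N.diff N.scale
  scale_right_distrib scale_right_diff_distrib scale_left_commute

lemma bilinear_nij_succ: "bilinear_product scale (\<succ>)"
  by (rule bilinear_productI) (unfold_locales, simp_all add: nijenhuis_expand)

lemma bilinear_nij_prec: "bilinear_product scale (\<prec>)"
  by (rule bilinear_productI) (unfold_locales, simp_all add: nijenhuis_expand)

text \<open>This is \<open>S\<close> of the opening sketch, and the next definition is
  \<open>T\<close>.\<close>

definition first_order_term :: "'a \<Rightarrow> 'a \<Rightarrow> 'a \<Rightarrow> 'a"
  where "first_order_term x y z = N (N (z \<cdot> y) \<cdot> x + x \<cdot> N (y \<cdot> z))"

definition second_order_term :: "'a \<Rightarrow> 'a \<Rightarrow> 'a \<Rightarrow> 'a"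
  where "second_order_term x y z = N (N ((z \<cdot> y) \<cdot> x + x \<cdot> (y \<cdot> z)))"

text \<open>Moving the negative terms of the anti-flexible law across the equation shows that the
  argument of \<open>N (N _)\<close> is already symmetric in x and z.\<close>

lemma second_order_term_swap: "second_order_term x y z = second_order_term z y x"
proof -
  have "(z \<cdot> y) \<cdot> x + x \<cdot> (y \<cdot> z) = (x \<cdot> y) \<cdot> z + z \<cdot> (y \<cdot> x)"
    using anti_flexible[of z y x] by (simp add: algebra_simps)
  then show ?thesis by (simp add: second_order_term_def)
qed

lemma nijenhuis_condition_iff:
  "nijenhuis_condition scale mul N \<longleftrightarrow>
    (\<forall>x y z. scale (3 / 2) (first_order_term x y z) = second_order_term x y z)"
  by (simp add: nijenhuis_condition_def first_order_term_def second_order_term_def)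

lemma first_associator_expansion:
  defines "h \<equiv> 1 / 2 :: 'k"
  shows "(x \<succ> y) \<prec> z - x \<succ> (y \<prec> z) =
    associator (N x) y (N z) - scale h (N (associator x y (N z) + associator (N x) y z))
    + scale h (N (N (associator x y z)))
    - scale (h - h * h) (N (N (x \<cdot> y) \<cdot> z - x \<cdot> N (y \<cdot> z)))"
  \<comment> \<open>Products of two values of \<open>N\<close> arise only as
    \<open>N (x \<cdot> y) \<cdot> N z\<close> and \<open>N x \<cdot> N (y \<cdot> z)\<close>.
    Folding 1/2 into \<open>h\<close> keeps it an opaque scalar.\<close>
  using nijenhuis[of "x \<cdot> y" z] nijenhuis[of x "y \<cdot> z"]
  unfolding h_def[symmetric]
  by (simp add: nijenhuis_expand associator_def scale_left_diff_distrib h_def[symmetric])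

text \<open>Exchanging x and z fixes every associator term, up to swapping the two summands under
  \<open>scale h\<close>. Only the terms with coefficient \<open>h - h * h\<close> = 1/4 survive in
  the difference.\<close>

lemma first_identity_iff:
  assumes "(2::'k) \<noteq> 0"
  shows "(x \<succ> y) \<prec> z - x \<succ> (y \<prec> z) = (z \<succ> y) \<prec> x - z \<succ> (y \<prec> x) \<longleftrightarrow>
    first_order_term x y z = first_order_term z y x"
proof -
  have "(4::'k) \<noteq> 0"
    using no_zero_divisors[OF assms assms] by simp
  have "(x \<succ> y) \<prec> z - x \<succ> (y \<prec> z) - ((z \<succ> y) \<prec> x - z \<succ> (y \<prec> x)) =
      scale (1 / 4) (first_order_term x y z - first_order_term z y x)"
    unfolding first_associator_expansion half_quarter_arith(1)[OF assms] first_order_term_def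
      associator_swap[of "N z" y "N x"] associator_swap[of z y x]
      associator_swap[of z y "N x"] associator_swap[of "N z" y x]
    by (simp add: N.add N.diff scale_right_distrib scale_right_diff_distrib)
  with \<open>4 \<noteq> 0\<close> show ?thesis
    by (metis eq_iff_diff_eq_0 divide_eq_0_iff one_neq_zero scale_eq_0_iff)
qed

text \<open>The two halves of \<open>N (x \<cdot> y)\<close> recombine, giving the product deformed
  by \<open>N\<close>. The Nijenhuis identity says that \<open>N\<close> maps it to
  \<open>N x \<cdot> N y\<close>.\<close>

lemma nij_succ_add_prec:
  assumes "(2::'k) \<noteq> 0"
  shows "x \<succ> y + x \<prec> y = N x \<cdot> y + x \<cdot> N y - N (x \<cdot> y)"
proof -
  have "scale (1 / 2) v + scale (1 / 2) v = v" for v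
    using assms by (simp flip: scale_left_distrib)
  then show ?thesis
    by (simp add: nijenhuis_succ_def nijenhuis_prec_def algebra_simps)
qed

lemma second_identity_left_expansion:
  assumes "(2::'k) \<noteq> 0"
  defines "h \<equiv> 1 / 2 :: 'k"
  shows "(x \<succ> y + x \<prec> y) \<succ> z - x \<succ> (y \<succ> z) =
    associator (N x) (N y) z - scale h (N (associator (N x) y z + associator x (N y) z))
    + scale h (N (N (x \<cdot> y) \<cdot> z)) + scale (h - h * h) (N (x \<cdot> N (y \<cdot> z)))
    - scale h (N (N (x \<cdot> (y \<cdot> z))))"
  \<comment> \<open>The identity is used both ways: \<open>N\<close> of the deformed product
    contracts to \<open>N x \<cdot> N y\<close>, while \<open>N x \<cdot> N (y \<cdot> z)\<close>
    gets expanded.\<close>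
  unfolding nij_succ_add_prec[OF assms(1)] unfolding nijenhuis_succ_def nijenhuis[symmetric]
  using nijenhuis[of x "y \<cdot> z"]
  by (simp add: nijenhuis_expand associator_def scale_left_diff_distrib h_def[symmetric])

text \<open>Mirror image of the left expansion, with the factors of each product reversed.\<close>

lemma second_identity_right_expansion:
  assumes "(2::'k) \<noteq> 0"
  defines "h \<equiv> 1 / 2 :: 'k"
  shows "(z \<prec> y) \<prec> x - z \<prec> (y \<prec> x + y \<succ> x) =
    associator z (N y) (N x) - scale h (N (associator z y (N x) + associator z (N y) x))
    - scale h (N (z \<cdot> N (y \<cdot> x))) - scale (h - h * h) (N (N (z \<cdot> y) \<cdot> x))
    + scale h (N (N ((z \<cdot> y) \<cdot> x)))"
  unfolding add.commute[of "y \<prec> x"] nij_succ_add_prec[OF assms(1)]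
  unfolding nijenhuis_prec_def nijenhuis[symmetric]
  using nijenhuis[of "z \<cdot> y" x]
  by (simp add: nijenhuis_expand associator_def scale_left_diff_distrib h_def[symmetric])

lemma second_identity_iff:
  assumes "(2::'k) \<noteq> 0"
  shows "(x \<succ> y + x \<prec> y) \<succ> z - x \<succ> (y \<succ> z) = (z \<prec> y) \<prec> x - z \<prec> (y \<prec> x + y \<succ> x) \<longleftrightarrow>
    scale (1 / 2) (first_order_term z y x) + scale (1 / 4) (first_order_term x y z)
      = scale (1 / 2) (second_order_term x y z)"
proof -
  have "(x \<succ> y + x \<prec> y) \<succ> z - x \<succ> (y \<succ> z) - ((z \<prec> y) \<prec> x - z \<prec> (y \<prec> x + y \<succ> x)) =
      scale (1 / 2) (first_order_term z y x) + scale (1 / 4) (first_order_term x y z)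
        - scale (1 / 2) (second_order_term x y z)"
    unfolding second_identity_left_expansion[OF assms] second_identity_right_expansion[OF assms]
      half_quarter_arith(1)[OF assms] first_order_term_def second_order_term_def
      associator_swap[of z "N y" "N x"] associator_swap[of z y "N x"] associator_swap[of z "N y" x]
    by (simp add: N.add scale_right_distrib)
  then show ?thesis
    by (metis eq_iff_diff_eq_0)
qed

text \<open>The symmetry of \<open>S\<close> stays a separate conjunct, because the condition yields
  it only when 3 is invertible.\<close>

lemma pre_anti_flexible_iff:
  assumes "(2::'k) \<noteq> 0"
  shows "pre_anti_flexible_algebra scale (\<prec>) (\<succ>) \<longleftrightarrow>
    nijenhuis_condition scale mul N \<and>
    (\<forall>x y z. first_order_term x y z = first_order_term z y x)"
proof -
  let ?S = first_order_term and ?T = second_order_term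
  have half: "scale (1 / 2) a = scale (1 / 2) b \<longleftrightarrow> a = b" for a b
    using assms by simp
  have scalars: "scale (1 / 2) v + scale (1 / 4) v = scale (1 / 2) (scale (3 / 2) v)" for v
    unfolding scale_left_distrib[symmetric] half_quarter_arith(2)[OF assms] scale_scale ..
  have "pre_anti_flexible_algebra scale (\<prec>) (\<succ>) \<longleftrightarrow>
      (\<forall>x y z. ?S x y z = ?S z y x) \<and>
      (\<forall>x y z. scale (1 / 2) (?S z y x) + scale (1 / 4) (?S x y z) = scale (1 / 2) (?T x y z))"
    unfolding pre_anti_flexible_algebra_def pre_anti_flexible_algebra_axioms_def
      first_identity_iff[OF assms] second_identity_iff[OF assms]
    using vector_space_axioms bilinear_nij_succ bilinear_nij_prec by blast
  also have "\<dots> \<longleftrightarrow> (\<forall>x y z. ?S x y z = ?S z y x) \<and> (\<forall>x y z. scale (3 / 2) (?S x y z) = ?T x y z)"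
    \<comment> \<open>Symmetry turns the left side into 3/4 of \<open>?S x y z\<close>; the common
      factor 1/2 then cancels.\<close>
    by (metis scalars half)
  finally show ?thesis
    unfolding nijenhuis_condition_iff by blast
qed

lemma first_order_term_swap:
  assumes "(2::'k) \<noteq> 0" "(3::'k) \<noteq> 0" "nijenhuis_condition scale mul N"
  shows "first_order_term x y z = first_order_term z y x"
proof -
  have "scale (3 / 2) (first_order_term x y z) = scale (3 / 2) (first_order_term z y x)"
    using assms(3) second_order_term_swap unfolding nijenhuis_condition_iff by metis
  then show ?thesis using assms(1,2) by simp
qed

end

lemma of_nat_prime_neq_0:
  assumes "prime p" "CHAR('k::field) \<noteq> p"
  shows "(of_nat p :: 'k) \<noteq> 0"
proof
  assume "(of_nat p :: 'k) = 0"
  then have "CHAR('k) dvd p"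
    by (simp only: of_nat_eq_0_iff_char_dvd)
  with assms(1) have "CHAR('k) = 1 \<or> CHAR('k) = p"
    unfolding prime_nat_iff by blast
  \<comment> \<open>The case \<open>CHAR('k) = 1\<close> is impossible since 1 and 0 differ in a
    field.\<close>
  with assms(2) show False
    by simp
qed

theorem theorem4p7:
  fixes scale :: "'k::field \<Rightarrow> 'a::ab_group_add \<Rightarrow> 'a"
    and mul :: "'a \<Rightarrow> 'a \<Rightarrow> 'a"
    and N :: "'a \<Rightarrow> 'a"
  assumes "CHAR('k) \<noteq> 2"
    and "anti_flexible_algebra scale mul"
    and "nijenhuis_operator scale mul N"
  shows "(pre_anti_flexible_algebra scale (nijenhuis_prec scale mul N) (nijenhuis_succ scale mul N)
            \<longrightarrow> nijenhuis_condition scale mul N) \<and>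
         (CHAR('k) \<noteq> 3 \<longrightarrow>
           (pre_anti_flexible_algebra scale (nijenhuis_prec scale mul N) (nijenhuis_succ scale mul N)
            \<longleftrightarrow> nijenhuis_condition scale mul N))"
proof -
  interpret nijenhuis_operator scale mul N by fact
  have two: "(2::'k) \<noteq> 0"
    using of_nat_prime_neq_0[OF two_is_prime_nat assms(1)] by simp
  have three: "(3::'k) \<noteq> 0" if "CHAR('k) \<noteq> 3"
    using of_nat_prime_neq_0[of 3, where 'k = 'k] that by simp
  show ?thesis
    \<comment> \<open>The forward implication drops the symmetry conjunct, so it includes
      characteristic 3; the converse recovers that conjunct from 3 being nonzero.\<close>
    using pre_anti_flexible_iff[OF two] first_order_term_swap[OF two three] by blast
qed

end
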